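(* Let $n\ge1$ be an integer. Then $$B_n(p,q,t,u,v,w,y)=\sum_{j=0}^{n}y^{j}\sum_{k=0}^{\lfloor (n-j)/2\rfloor}b_{n,k,j}(p,q)\,(tw)^k\,(qu+tv)^{n-j-2k}.$$
   Context: Let $\mathfrak{S}_n$ be the set of permutations $\sigma$ of $[n]=\{1,\dots,n\}$, and for $\sigma\in\mathfrak{S}_n$ let $\mathrm{cros}\,\sigma=\#\{(i,j)\in[n]^2: (i<j\le\sigma(i)<\sigma(j))\text{ or }(i>j>\sigma(i)>\sigma(j))\}$; $\mathrm{nest}\,\sigma=\#\{(i,j)\in[n]^2: (i<j\le\sigma(j)<\sigma(i))\text{ or }(i>j>\sigma(j)>\sigma(i))\}$; $\mathrm{drop}\,\sigma=\#\{i\in[n]: i>\sigma(i)\}$; $\mathrm{cda}\,\sigma=\#\{x:\sigma^{-1}(x)<x<\sigma(x)\}$; $\mathrm{cdd}\,\sigma=\#\{x:\sigma^{-1}(x)>x>\sigma(x)\}$; $\mathrm{cvalley}\,\sigma=\#\{x:\sigma^{-1}(x)>x<\sigma(x)\}$; $\mathrm{fix}\,\sigma=\#\{x:\sigma(x)=x\}$. Define $$B_n(p,q,t,u,v,w,y)=\sum_{\sigma\in\mathfrak{S}_n}p^{\mathrm{nest}\,\sigma}q^{\mathrm{cros}\,\sigma}t^{\mathrm{drop}\,\sigma}u^{\mathrm{cda}\,\sigma}v^{\mathrm{cdd}\,\sigma}w^{\mathrm{cvalley}\,\sigma}y^{\mathrm{fix}\,\sigma},$$ and define the polynomials $b_{n,k,j}(p,q)$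 as the coefficients in $$B_n(p,q,1,0,1,w,y)=\sum_{k,j\ge0}b_{n,k,j}(p,q)\,w^ky^j\qquad(\text{with }0^0=1);$$ equivalently, $b_{n,k,j}(p,q)=\sum_\sigma p^{\mathrm{nest}\,\sigma}q^{\mathrm{cros}\,\sigma}$ over all $\sigma\in\mathfrak{S}_n$ with $\mathrm{cvalley}\,\sigma=k$, $\mathrm{fix}\,\sigma=j$ and $\mathrm{cda}\,\sigma=0$. *)

theory Defs
  imports
    "HOL-Combinatorics.Permutations"
    "HOL-Computational_Algebra.Polynomial"
begin

definition perms :: "nat \<Rightarrow> (nat \<Rightarrow> nat) set" where
  "perms n = {\<sigma>. \<sigma> permutes {1..n}}"

definition cros :: "nat \<Rightarrow> (nat \<Rightarrow> nat) \<Rightarrow> nat" where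
  "cros n \<sigma> = card {(i, j) \<in> {1..n} \<times> {1..n}.
     (i < j \<and> j \<le> \<sigma> i \<and> \<sigma> i < \<sigma> j) \<or> (i > j \<and> j > \<sigma> i \<and> \<sigma> i > \<sigma> j)}"

definition nest :: "nat \<Rightarrow> (nat \<Rightarrow> nat) \<Rightarrow> nat" where
  "nest n \<sigma> = card {(i, j) \<in> {1..n} \<times> {1..n}.
     (i < j \<and> j \<le> \<sigma> j \<and> \<sigma> j < \<sigma> i) \<or> (i > j \<and> j > \<sigma> j \<and> \<sigma> j > \<sigma> i)}"

definition drops :: "nat \<Rightarrow> (nat \<Rightarrow> nat) \<Rightarrow> nat" where
  "drops n \<sigma> = card {i \<in> {1..n}. i > \<sigma> i}"

definition cda :: "nat \<Rightarrow> (nat \<Rightarrow> nat) \<Rightarrow> nat" where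
  "cda n \<sigma> = card {x \<in> {1..n}. inv \<sigma> x < x \<and> x < \<sigma> x}"

definition cdd :: "nat \<Rightarrow> (nat \<Rightarrow> nat) \<Rightarrow> nat" where
  "cdd n \<sigma> = card {x \<in> {1..n}. inv \<sigma> x > x \<and> x > \<sigma> x}"

definition cvalley :: "nat \<Rightarrow> (nat \<Rightarrow> nat) \<Rightarrow> nat" where
  "cvalley n \<sigma> = card {x \<in> {1..n}. inv \<sigma> x > x \<and> x < \<sigma> x}"

definition fixpts :: "nat \<Rightarrow> (nat \<Rightarrow> nat) \<Rightarrow> nat" where
  "fixpts n \<sigma> = card {x \<in> {1..n}. \<sigma> x = x}"

text \<open>
  The polynomial \<open>B\<^sub>n(p,q,t,u,v,w,y)\<close> is rendered by its evaluations in arbitrary commutative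
  rings; the ring may itself be a polynomial ring with the arguments as indeterminates.
\<close>

definition B :: "nat \<Rightarrow> 'a::comm_ring_1 \<Rightarrow> 'a \<Rightarrow> 'a \<Rightarrow> 'a \<Rightarrow> 'a \<Rightarrow> 'a \<Rightarrow> 'a \<Rightarrow> 'a" where
  "B n p q t u v w y = (\<Sum>\<sigma>\<in>perms n. p ^ nest n \<sigma> * q ^ cros n \<sigma> * t ^ drops n \<sigma> *
     u ^ cda n \<sigma> * v ^ cdd n \<sigma> * w ^ cvalley n \<sigma> * y ^ fixpts n \<sigma>)"

text \<open>
  \<open>b n k j p q\<close> is the coefficient of \<open>w\<^sup>k y\<^sup>j\<close> in \<open>B\<^sub>n(p,q,1,0,1,w,y)\<close>, computed in
  \<open>R[y][w]\<close>: the outer indeterminate \<open>[:0, 1:]\<close> is \<open>w\<close>, the inner one \<open>[:[:0, 1:]:]\<close> is \<open>y\<close>,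
  and \<open>p\<close>, \<open>q\<close> are embedded as constants.
\<close>

definition b :: "nat \<Rightarrow> nat \<Rightarrow> nat \<Rightarrow> 'a::comm_ring_1 \<Rightarrow> 'a \<Rightarrow> 'a" where
  "b n k j p q = coeff (coeff (B n [:[:p:]:] [:[:q:]:] 1 0 1 [:0, 1:] [:[:0, 1:]:]) k) j"

lemma finite_perms: "finite (perms n)"
  by (simp add: perms_def finite_permutations)

lemma const_poly_power: "[:a:] ^ m = [:a ^ m:]"
  for a :: "'a::comm_ring_1"
  by (induction m) (simp_all add: one_pCons)

lemma b_eq_sum:
  "b n k j p q = (\<Sum>\<sigma> | \<sigma> \<in> perms n \<and> cvalley n \<sigma> = k \<and> fixpts n \<sigma> = j \<and> cda n \<sigma> = 0.
     p ^ nest n \<sigma> * q ^ cros n \<sigma>)"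
proof -
  have X: "[:0, 1:] ^ m = monom (1 :: 'c::comm_ring_1) m" for m
    by (simp add: monom_altdef)
  have "coeff (coeff ([:[:p:]:] ^ c * [:[:q:]:] ^ d * 1 ^ e * 0 ^ f * 1 ^ g * [:0, 1:] ^ h *
      [:[:0, 1:]:] ^ i) k) j = (if h = k \<and> i = j \<and> f = 0 then p ^ c * q ^ d else 0)"
    for c d e f g h i
    by (cases "f = 0") (simp_all add: const_poly_power X mult_monom smult_monom mult.commute power_0_left)
  then have "b n k j p q = (\<Sum>\<sigma>\<in>perms n.
      if cvalley n \<sigma> = k \<and> fixpts n \<sigma> = j \<and> cda n \<sigma> = 0 then p ^ nest n \<sigma> * q ^ cros n \<sigma> else 0)"
    unfolding b_def B_def coeff_sum by simp
  also have "\<dots> = (\<Sum>\<sigma> | \<sigma> \<in> perms n \<and> cvalley n \<sigma> = k \<and> fixpts n \<sigma> = j \<and> cda n \<sigma> = 0.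
     p ^ nest n \<sigma> * q ^ cros n \<sigma>)"
    by (rule sum.inter_filter[OF finite_perms, symmetric])
  finally show ?thesis .
qed

end

theory Submission imports Defs begin

text \<open>
  Scan a permutation from left to right. What is visible after \<open>k\<close> steps is its restriction to
  \<open>{1..k} \<times> {1..k}\<close>, a partial injection with equally many, say \<open>h\<close>, unmatched sources and unmatched
  targets. Inserting \<open>k + 1\<close> opens arcs, or closes an arc at one of the \<open>h\<close> unmatched sources or
  targets, or both. If each crossing and each nesting is charged to the step at which the first of the
  two arcs is closed, summing over the choices gives the Motzkin-path weights \<open>w\<close> (cyclic valley),
  \<open>q u [h]\<close> (double ascent), \<open>t v [h]\<close> (double descent), \<open>y p\<^sup>h\<close> (fixed point) and \<open>t [h]\<^sup>2\<close>
  (cyclic peak), where \<open>[h]\<close> is the \<open>(p, q)\<close>-integer. The factor \<open>q\<close> for double ascents comes from the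
  arc newly opened at \<open>k + 1\<close>, which crosses the arc that is closed there. Hence \<open>u\<close> and \<open>v\<close> enter
  only through \<open>q u + t v\<close>, so one may replace \<open>(u, v, t)\<close> by \<open>(0, q u + t v, 1)\<close> and \<open>w\<close> by \<open>t w\<close>,
  cyclic peaks and valleys being equinumerous.
\<close>

section \<open>Partial permutations of \<open>{1..k}\<close> and their one-point extensions\<close>

definition partial_perms :: "nat \<Rightarrow> (nat \<times> nat) set set" where
  "partial_perms k = {R. R \<subseteq> {1..k} \<times> {1..k} \<and> single_valued R \<and> single_valued (R\<inverse>)}"

text \<open>The bound on \<open>j\<close> makes this set depend only on the part of \<open>R\<close>
  inside the square of side \<open>k\<close>. It can therefore be evaluated on the graph of a whole
  permutation, where it lists the arcs that start by \<open>k\<close> and end later.\<close>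

definition open_src :: "nat \<Rightarrow> (nat \<times> nat) set \<Rightarrow> nat set" where
  "open_src k R = {i \<in> {1..k}. \<forall>j\<in>{1..k}. (i, j) \<notin> R}"

definition open_tgt :: "nat \<Rightarrow> (nat \<times> nat) set \<Rightarrow> nat set" where
  "open_tgt k R = {j \<in> {1..k}. \<forall>i\<in>{1..k}. (i, j) \<notin> R}"

text \<open>The sets of pairs that the point \<open>Suc k\<close> can add to \<open>R\<close>. Once
  the permutation is complete, the five shapes make this point, in order, a cyclic valley, a fixed
  point, a double ascent, a double descent or a cyclic peak.\<close>

definition extensions :: "nat \<Rightarrow> (nat \<times> nat) set \<Rightarrow> (nat \<times> nat) set set" where
  "extensions k R = {{}, {(Suc k, Suc k)}} \<union> (\<lambda>a. {(a, Suc k)}) ` open_src k R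
     \<union> (\<lambda>b. {(Suc k, b)}) ` open_tgt k R
     \<union> (\<lambda>(a, b). {(a, Suc k), (Suc k, b)}) ` (open_src k R \<times> open_tgt k R)"

lemma finite_open_src [simp]: "finite (open_src k R)"
  by (simp add: open_src_def)

lemma finite_open_tgt [simp]: "finite (open_tgt k R)"
  by (simp add: open_tgt_def)

lemma finite_extensions: "finite (extensions k R)"
  by (simp add: extensions_def)

lemma finite_partial_perms: "finite (partial_perms k)"
  by (rule finite_subset[of _ "Pow ({1..k} \<times> {1..k})"]) (auto simp: partial_perms_def)

lemma insert_partial_perms:
  assumes "R \<in> partial_perms k" "i \<in> {1..k}" "j \<in> {1..k}" "i \<notin> Domain R" "j \<notin> Range R"
  shows "insert (i, j) R \<in> partial_perms k"
proof -
  have "single_valued (insert (i, j) R)" "single_valued ((insert (i, j) R)\<inverse>)"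
    using assms by (auto simp: partial_perms_def single_valued_def)
  with assms show ?thesis by (simp add: partial_perms_def)
qed

lemma partial_perms_mono: "R \<in> partial_perms k \<Longrightarrow> R \<in> partial_perms (Suc k)"
  by (fastforce simp: partial_perms_def)

lemma extension_in_partial_perms:
  assumes "R \<in> partial_perms k" "X \<in> extensions k R"
  shows "R \<union> X \<in> partial_perms (Suc k)"
proof -
  have R: "R \<in> partial_perms (Suc k)" and sub: "R \<subseteq> {1..k} \<times> {1..k}"
    using assms(1) by (auto intro: partial_perms_mono simp: partial_perms_def)
  have new: "Suc k \<notin> Domain R" "Suc k \<notin> Range R"
    using sub by auto
  have src: "a \<in> {1..Suc k}" "a \<noteq> Suc k" "a \<notin> Domain R" if "a \<in> open_src k R" for a
    using that sub by (auto simp: open_src_def)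
  have tgt: "b \<in> {1..Suc k}" "b \<noteq> Suc k" "b \<notin> Range R" if "b \<in> open_tgt k R" for b
    using that sub by (auto simp: open_tgt_def)
  have one: "insert (i, j) R \<in> partial_perms (Suc k)"
    if "i \<in> {1..Suc k}" "j \<in> {1..Suc k}" "i \<notin> Domain R" "j \<notin> Range R" for i j
    using insert_partial_perms[OF R] that by blast
  \<comment> \<open>Since \<open>a\<close> and \<open>b\<close> are at most \<open>k\<close>, the
    first insertion uses up neither the source \<open>Suc k\<close> nor the target
    \<open>b\<close>.\<close>
  have two: "insert (Suc k, b) (insert (a, Suc k) R) \<in> partial_perms (Suc k)"
    if "a \<in> open_src k R" "b \<in> open_tgt k R" for a b
    using one[of a "Suc k"] src[OF that(1)] tgt[OF that(2)] new
    by (intro insert_partial_perms[of "insert (a, Suc k) R"]) auto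
  consider "X = {}" | "X = {(Suc k, Suc k)}"
    | a where "X = {(a, Suc k)}" "a \<in> open_src k R"
    | b where "X = {(Suc k, b)}" "b \<in> open_tgt k R"
    | a b where "X = {(a, Suc k), (Suc k, b)}" "a \<in> open_src k R" "b \<in> open_tgt k R"
    using assms(2) by (auto simp: extensions_def)
  then show ?thesis
  proof cases
    case 1
    with R show ?thesis by simp
  next
    case 2
    with one[of "Suc k" "Suc k"] new show ?thesis by simp
  next
    case 3
    with one[of a "Suc k"] src[of a] new show ?thesis by simp
  next
    case 4
    with one[of "Suc k" b] tgt[of b] new show ?thesis by simp
  next
    case 5
    then have "R \<union> X = insert (Suc k, b) (insert (a, Suc k) R)" by blast
    with 5 two[of a b] show ?thesis by simp
  qed
qed

lemma extension_outside:
  assumes "X \<in> extensions k R"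
  shows "X \<inter> {1..k} \<times> {1..k} = {}"
  using assms by (auto simp: extensions_def)

lemma restrict_partial_perm:
  assumes "R \<in> partial_perms (Suc k)"
  shows "R \<inter> {1..k} \<times> {1..k} \<in> partial_perms k"
  using assms by (auto simp: partial_perms_def single_valued_def)

text \<open>A pair outside the old square has \<open>Suc k\<close> as an entry. Injectivity in both
  directions allows at most one pair with source \<open>Suc k\<close> and one with target
  \<open>Suc k\<close>, and the two coincide if there is a loop.\<close>

lemma remainder_in_extensions:
  assumes "R \<in> partial_perms (Suc k)"
  shows "R - {1..k} \<times> {1..k} \<in> extensions k (R \<inter> {1..k} \<times> {1..k})"
proof -
  let ?x = "Suc k" and ?Q = "R \<inter> {1..k} \<times> {1..k}" and ?X = "R - {1..k} \<times> {1..k}"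
  have sub: "R \<subseteq> {1..?x} \<times> {1..?x}"
    and fn: "\<And>i j j'. (i, j) \<in> R \<Longrightarrow> (i, j') \<in> R \<Longrightarrow> j = j'"
    and inj: "\<And>i i' j. (i, j) \<in> R \<Longrightarrow> (i', j) \<in> R \<Longrightarrow> i = i'"
    using assms by (auto simp: partial_perms_def single_valued_def)
  have X: "?X = {(i, j) \<in> R. i = ?x \<or> j = ?x}"
    using sub by (auto simp: le_Suc_eq)
  have src: "a \<in> open_src k ?Q" if a: "(a, ?x) \<in> R" "a \<noteq> ?x" for a
  proof -
    have "a \<in> {1..k}" using a sub by auto
    moreover have "(a, j) \<notin> R" if "j \<in> {1..k}" for j
      using fn[OF a(1), of j] that by auto
    ultimately show ?thesis by (simp add: open_src_def)
  qed
  have tgt: "b \<in> open_tgt k ?Q" if b: "(?x, b) \<in> R" "b \<noteq> ?x" for b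
  proof -
    have "b \<in> {1..k}" using b sub by auto
    moreover have "(i, b) \<notin> R" if "i \<in> {1..k}" for i
      using inj[OF b(1), of i] that by auto
    ultimately show ?thesis by (simp add: open_tgt_def)
  qed
  show ?thesis
  proof (cases "(?x, ?x) \<in> R")
    case True
    then have "?X = {(?x, ?x)}"
      unfolding X using fn inj by blast
    then show ?thesis by (simp add: extensions_def)
  next
    case False
    consider "\<forall>a. (a, ?x) \<notin> R" "\<forall>b. (?x, b) \<notin> R"
      | a where "(a, ?x) \<in> R" "\<forall>b. (?x, b) \<notin> R"
      | b where "\<forall>a. (a, ?x) \<notin> R" "(?x, b) \<in> R"
      | a b where "(a, ?x) \<in> R" "(?x, b) \<in> R"
      by blast
    then show ?thesis
    proof cases
      case 1
      then have "?X = {}" unfolding X by blast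
      then show ?thesis by (simp add: extensions_def)
    next
      case 2
      then have "?X = {(a, ?x)}" unfolding X using inj by blast
      moreover have "a \<in> open_src k ?Q" using 2 False src by blast
      ultimately show ?thesis by (auto simp: extensions_def)
    next
      case 3
      then have "?X = {(?x, b)}" unfolding X using fn by blast
      moreover have "b \<in> open_tgt k ?Q" using 3 False tgt by blast
      ultimately show ?thesis by (auto simp: extensions_def)
    next
      case 4
      then have "?X = {(a, ?x), (?x, b)}" unfolding X using fn inj by blast
      moreover have "a \<in> open_src k ?Q" "b \<in> open_tgt k ?Q" using 4 False src tgt by metis+
      ultimately show ?thesis by (auto simp: extensions_def)
    qed
  qed
qed

text \<open>Cutting a relation along the square of side \<open>k\<close> is inverse to forming
  \<open>R \<union> X\<close>.\<close>

lemma sum_partial_perms_Suc: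
  "(\<Sum>R\<in>partial_perms (Suc k). F R) = (\<Sum>R\<in>partial_perms k. \<Sum>X\<in>extensions k R. F (R \<union> X))"
proof -
  define r d :: "(nat \<times> nat) set \<Rightarrow> (nat \<times> nat) set"
    where "r = (\<lambda>R. R \<inter> {1..k} \<times> {1..k})" and "d = (\<lambda>R. R - {1..k} \<times> {1..k})"
  have restr: "r (R \<union> X) = R" "d (R \<union> X) = X"
    if "R \<in> partial_perms k" "X \<in> extensions k R" for R X
    using that(1) extension_outside[OF that(2)] unfolding r_def d_def partial_perms_def by blast+
  have split: "r R \<union> d R = R" for R
    unfolding r_def d_def by blast
  have ext: "r R \<in> partial_perms k" "d R \<in> extensions k (r R)"
    if "R \<in> partial_perms (Suc k)" for R
    using restrict_partial_perm[OF that] remainder_in_extensions[OF that] unfolding r_def d_def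
    by blast+
  have "(\<Sum>R\<in>partial_perms (Suc k). F R) =
    (\<Sum>(R, X)\<in>(SIGMA R:partial_perms k. extensions k R). F (R \<union> X))"
    by (rule sum.reindex_bij_witness[where i = "\<lambda>(R, X). R \<union> X" and j = "\<lambda>R. (r R, d R)"])
      (auto simp: restr split ext extension_in_partial_perms)
  also have "\<dots> = (\<Sum>R\<in>partial_perms k. \<Sum>X\<in>extensions k R. F (R \<union> X))"
    by (rule sum.Sigma[symmetric]) (simp_all add: finite_partial_perms finite_extensions)
  finally show ?thesis .
qed

text \<open>Open points lie below \<open>Suc k\<close>, so the five families of extensions are
  disjoint and each is parametrised injectively.\<close>

lemma sum_extensions:
  fixes F :: "(nat \<times> nat) set \<Rightarrow> 'a::comm_monoid_add"
  shows "(\<Sum>X\<in>extensions k R. F X) = F {} + F {(Suc k, Suc k)}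
    + (\<Sum>a\<in>open_src k R. F {(a, Suc k)}) + (\<Sum>b\<in>open_tgt k R. F {(Suc k, b)})
    + (\<Sum>a\<in>open_src k R. \<Sum>b\<in>open_tgt k R. F {(a, Suc k), (Suc k, b)})"
proof -
  have D: "a \<in> open_src k R \<Longrightarrow> a < Suc k" and E: "a \<in> open_tgt k R \<Longrightarrow> a < Suc k" for a
    by (auto simp: open_src_def open_tgt_def)
  have 1: "(\<Sum>X\<in>(\<lambda>a. {(a, Suc k)}) ` open_src k R. F X) = (\<Sum>a\<in>open_src k R. F {(a, Suc k)})"
    by (subst sum.reindex) (auto simp: inj_on_def)
  have 2: "(\<Sum>X\<in>(\<lambda>a. {(Suc k, a)}) ` open_tgt k R. F X) = (\<Sum>a\<in>open_tgt k R. F {(Suc k, a)})"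
    by (subst sum.reindex) (auto simp: inj_on_def)
  have "inj_on (\<lambda>(a, b). {(a, Suc k), (Suc k, b)}) (open_src k R \<times> open_tgt k R)"
    using D E by (fastforce simp: inj_on_def doubleton_eq_iff)
  then have 3: "(\<Sum>X\<in>(\<lambda>(a, b). {(a, Suc k), (Suc k, b)}) ` (open_src k R \<times> open_tgt k R). F X)
      = (\<Sum>a\<in>open_src k R. \<Sum>b\<in>open_tgt k R. F {(a, Suc k), (Suc k, b)})"
    by (subst sum.reindex) (auto simp: sum.cartesian_product comp_def case_prod_unfold)
  have disj: "{{}, {(Suc k, Suc k)}} \<inter> (\<lambda>a. {(a, Suc k)}) ` open_src k R = {}"
    "({{}, {(Suc k, Suc k)}} \<union> (\<lambda>a. {(a, Suc k)}) ` open_src k R)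
      \<inter> (\<lambda>e. {(Suc k, e)}) ` open_tgt k R = {}"
    "({{}, {(Suc k, Suc k)}} \<union> (\<lambda>a. {(a, Suc k)}) ` open_src k R \<union> (\<lambda>e. {(Suc k, e)}) ` open_tgt k R)
      \<inter> (\<lambda>(a, e). {(a, Suc k), (Suc k, e)}) ` (open_src k R \<times> open_tgt k R) = {}"
    using D E by (fastforce simp: doubleton_eq_iff set_eq_iff)+
  have "(\<Sum>X\<in>{{}, {(Suc k, Suc k)}}. F X) = F {} + F {(Suc k, Suc k)}"
    by simp
  then show ?thesis
    unfolding extensions_def using disj by (simp only: sum.union_disjoint finite_imageI finite_cartesian_product
        finite_open_src finite_open_tgt finite_UnI finite.intros 1 2 3)
qed

section \<open>Crossings, nestings and weights charged to a single point\<close>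

text \<open>A nesting is charged to the larger endpoint of its inner arc: the target of an arc
  \<open>j \<le> x\<close>, the source of a drop. The outer arc is still open there. Fixed points
  enter through the weak inequality of the first sum only.\<close>

definition nest_at :: "nat \<Rightarrow> (nat \<times> nat) set \<Rightarrow> nat" where
  "nest_at x R = (\<Sum>j | (j, x) \<in> R \<and> j \<le> x. card {i \<in> open_src x R. i < j})
     + (\<Sum>j | (x, j) \<in> R \<and> j < x. card {i \<in> open_tgt x R. i < j})"

text \<open>In the first sum \<open>i = x\<close> may occur, because an arc ending at
  \<open>x\<close> crosses one starting at \<open>x\<close>. The bound \<open>i < x\<close> in the
  second sum excludes the analogous pair of drops, in accordance with the strict inequalities in
  \<open>cros\<close>.\<close>

definition cros_at :: "nat \<Rightarrow> (nat \<times> nat) set \<Rightarrow> nat" where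
  "cros_at x R = (\<Sum>j | (j, x) \<in> R \<and> j \<le> x. card {i \<in> open_src x R. j < i})
     + (\<Sum>j | (x, j) \<in> R \<and> j < x. card {i \<in> open_tgt x R. j < i \<and> i < x})"

text \<open>
  Cyclic peaks get weight \<open>1\<close>: they are equinumerous with cyclic valleys, so the factor \<open>t\<close> of a peak
  is moved into \<open>w\<close>.
\<close>

definition vertex_weight :: "'a \<Rightarrow> 'a \<Rightarrow> 'a \<Rightarrow> 'a \<Rightarrow> nat \<Rightarrow> (nat \<times> nat) set \<Rightarrow> 'a::comm_ring_1" where
  "vertex_weight u v w y x R =
    (if (x, x) \<in> R then y
     else if \<exists>i<x. (i, x) \<in> R then (if \<exists>i<x. (x, i) \<in> R then 1 else u)
     else (if \<exists>i<x. (x, i) \<in> R then v else w))"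

definition step :: "'a \<Rightarrow> 'a \<Rightarrow> 'a \<Rightarrow> 'a \<Rightarrow> 'a \<Rightarrow> 'a \<Rightarrow> nat \<Rightarrow> (nat \<times> nat) set \<Rightarrow> 'a::comm_ring_1" where
  "step p q u v w y x R = p ^ nest_at x R * q ^ cros_at x R * vertex_weight u v w y x R"

text \<open>Everything in \<open>step\<close> reads only pairs with both entries at most
  \<open>x\<close>, so the factor of a point survives all later insertions.\<close>

lemma step_cong:
  assumes "\<And>i j. i \<le> x \<Longrightarrow> j \<le> x \<Longrightarrow> (i, j) \<in> R \<longleftrightarrow> (i, j) \<in> S"
  shows "step p q u v w y x R = step p q u v w y x S"
proof -
  have "open_src x R = open_src x S" "open_tgt x R = open_tgt x S"
    using assms by (auto simp: open_src_def open_tgt_def)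
  moreover have "{j. (j, x) \<in> R \<and> j \<le> x} = {j. (j, x) \<in> S \<and> j \<le> x}"
    "{j. (x, j) \<in> R \<and> j < x} = {j. (x, j) \<in> S \<and> j < x}"
    "(x, x) \<in> R \<longleftrightarrow> (x, x) \<in> S"
    "(\<exists>i<x. (i, x) \<in> R) \<longleftrightarrow> (\<exists>i<x. (i, x) \<in> S)"
    "(\<exists>i<x. (x, i) \<in> R) \<longleftrightarrow> (\<exists>i<x. (x, i) \<in> S)"
    using assms by (auto simp: less_imp_le)
  ultimately show ?thesis
    by (simp only: step_def nest_at_def cros_at_def vertex_weight_def)
qed

definition weight :: "'a \<Rightarrow> 'a \<Rightarrow> 'a \<Rightarrow> 'a \<Rightarrow> 'a \<Rightarrow> 'a \<Rightarrow> nat \<Rightarrow> (nat \<times> nat) set \<Rightarrow> 'a::comm_ring_1" where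
  "weight p q u v w y k R = (\<Prod>x=1..k. step p q u v w y x R)"

lemma weight_extension:
  assumes "X \<in> extensions k R"
  shows "weight p q u v w y (Suc k) (R \<union> X)
    = weight p q u v w y k R * step p q u v w y (Suc k) (R \<union> X)"
proof -
  have "step p q u v w y x (R \<union> X) = step p q u v w y x R" if "x \<in> {1..k}" for x
    by (rule step_cong) (use that assms in \<open>auto simp: extensions_def\<close>)
  then show ?thesis by (simp add: weight_def)
qed

section \<open>The factor contributed by each kind of extension\<close>

lemma Suc_notin_open: "Suc k \<notin> open_src k R" "Suc k \<notin> open_tgt k R"
  by (auto simp: open_src_def open_tgt_def)

lemma open_less: "i \<in> open_src k R \<Longrightarrow> i < Suc k" "i \<in> open_tgt k R \<Longrightarrow> i < Suc k"
  by (auto simp: open_src_def open_tgt_def)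

lemma sum_singleton: "(\<Sum>j\<in>{a}. f j) = f a"
  by simp

context
  fixes k :: nat and R :: "(nat \<times> nat) set" and p q u v w y :: "'a::comm_ring_1"
  assumes R: "R \<in> partial_perms k"
begin

lemma partial_perms_notin: "(i, Suc k) \<notin> R" "(Suc k, i) \<notin> R"
  using R by (auto simp: partial_perms_def)

lemma open_src_extension:
  "open_src (Suc k) (R \<union> X) = {i \<in> insert (Suc k) (open_src k R). \<forall>j\<in>{1..Suc k}. (i, j) \<notin> X}"
  using partial_perms_notin by (auto simp: open_src_def le_Suc_eq)

lemma open_tgt_extension:
  "open_tgt (Suc k) (R \<union> X) = {j \<in> insert (Suc k) (open_tgt k R). \<forall>i\<in>{1..Suc k}. (i, j) \<notin> X}"
  using partial_perms_notin by (auto simp: open_tgt_def le_Suc_eq)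

text \<open>No arc is closed, so both exponents vanish. The union with the empty set matches the
  first term of \<open>sum_extensions\<close>.\<close>

lemma step_opener: "step p q u v w y (Suc k) (R \<union> {}) = w"
  by (simp add: step_def nest_at_def cros_at_def vertex_weight_def partial_perms_notin)

text \<open>All open sources lie to the left of the loop, so each of their arcs nests it and none
  crosses it.\<close>

lemma step_fixed: "step p q u v w y (Suc k) (R \<union> {(Suc k, Suc k)}) = y * p ^ card (open_src k R)"
proof -
  have src: "open_src (Suc k) (R \<union> {(Suc k, Suc k)}) = open_src k R"
    unfolding open_src_extension using open_less by auto
  have cut: "{i \<in> open_src k R. i < Suc k} = open_src k R" "{i \<in> open_src k R. Suc k < i} = {}"
    using open_less by force+
  have arcs: "{j. (j, Suc k) \<in> R \<union> {(Suc k, Suc k)} \<and> j \<le> Suc k} = {Suc k}"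
    "{j. (Suc k, j) \<in> R \<union> {(Suc k, Suc k)} \<and> j < Suc k} = {}"
    using partial_perms_notin by auto
  have vertex: "vertex_weight u v w y (Suc k) (R \<union> {(Suc k, Suc k)}) = y"
    unfolding vertex_weight_def using partial_perms_notin by auto
  show ?thesis
    unfolding step_def nest_at_def cros_at_def vertex arcs sum_singleton sum.empty src cut
    by (simp add: power_add mult.commute mult.left_commute)
qed

text \<open>The closing arc is nested in the arcs from open sources left of \<open>a\<close> and
  crossed by those from open sources right of \<open>a\<close>.\<close>

lemma step_source:
  assumes a: "a \<in> open_src k R"
  shows "step p q u v w y (Suc k) (R \<union> {(a, Suc k)})
    = q * u * (p ^ card {i \<in> open_src k R. i < a} * q ^ card {i \<in> open_src k R. a < i})"
proof -
  let ?R = "R \<union> {(a, Suc k)}"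
  have less: "a < Suc k" using a open_less by auto
  \<comment> \<open>\<open>Suc k\<close> replaces \<open>a\<close> among the open sources; lying to
    the right of \<open>a\<close>, it yields the extra factor \<open>q\<close>.\<close>
  have "open_src (Suc k) ?R = insert (Suc k) (open_src k R - {a})"
    unfolding open_src_extension using less by auto
  then have cut: "{i \<in> open_src (Suc k) ?R. i < a} = {i \<in> open_src k R. i < a}"
    "{i \<in> open_src (Suc k) ?R. a < i} = insert (Suc k) {i \<in> open_src k R. a < i}"
    using less by auto
  have ins: "card (insert (Suc k) {i \<in> open_src k R. a < i}) = Suc (card {i \<in> open_src k R. a < i})"
    using Suc_notin_open by (intro card_insert_disjoint) auto
  have arcs: "{j. (j, Suc k) \<in> ?R \<and> j \<le> Suc k} = {a}"
    "{j. (Suc k, j) \<in> ?R \<and> j < Suc k} = {}"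
    using partial_perms_notin less by auto
  have vertex: "vertex_weight u v w y (Suc k) ?R = u"
    unfolding vertex_weight_def using partial_perms_notin less by auto
  show ?thesis
    unfolding step_def nest_at_def cros_at_def vertex arcs sum_singleton sum.empty cut ins
    by (simp add: power_add mult.commute mult.left_commute)
qed

text \<open>\<open>Suc k\<close> becomes an open target here, but \<open>cros_at\<close> counts only
  targets below it; hence there is no extra \<open>q\<close>.\<close>

lemma step_target:
  assumes e: "e \<in> open_tgt k R"
  shows "step p q u v w y (Suc k) (R \<union> {(Suc k, e)})
    = v * (p ^ card {i \<in> open_tgt k R. i < e} * q ^ card {i \<in> open_tgt k R. e < i})"
proof -
  let ?R = "R \<union> {(Suc k, e)}"
  have less: "e < Suc k" using e open_less by auto
  have "open_tgt (Suc k) ?R = insert (Suc k) (open_tgt k R - {e})"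
    unfolding open_tgt_extension using less by auto
  then have cut: "{i \<in> open_tgt (Suc k) ?R. i < e} = {i \<in> open_tgt k R. i < e}"
    "{i \<in> open_tgt (Suc k) ?R. e < i \<and> i < Suc k} = {i \<in> open_tgt k R. e < i}"
    using less open_less by auto
  have arcs: "{j. (j, Suc k) \<in> ?R \<and> j \<le> Suc k} = {}"
    "{j. (Suc k, j) \<in> ?R \<and> j < Suc k} = {e}"
    using partial_perms_notin less by auto
  have vertex: "vertex_weight u v w y (Suc k) ?R = v"
    unfolding vertex_weight_def using partial_perms_notin less by auto
  show ?thesis
    unfolding step_def nest_at_def cros_at_def vertex arcs sum_singleton sum.empty cut
    by (simp add: power_add mult.commute mult.left_commute)
qed

text \<open>\<open>Suc k\<close> is left open in neither direction, so the two rank weights simply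
  multiply.\<close>

lemma step_source_target:
  assumes a: "a \<in> open_src k R" and e: "e \<in> open_tgt k R"
  shows "step p q u v w y (Suc k) (R \<union> {(a, Suc k), (Suc k, e)})
    = (p ^ card {i \<in> open_src k R. i < a} * q ^ card {i \<in> open_src k R. a < i})
      * (p ^ card {i \<in> open_tgt k R. i < e} * q ^ card {i \<in> open_tgt k R. e < i})"
proof -
  let ?R = "R \<union> {(a, Suc k), (Suc k, e)}"
  have less: "a < Suc k" "e < Suc k" using a e open_less by auto
  have range: "a \<in> {1..Suc k}" "e \<in> {1..Suc k}"
    using a e by (auto simp: open_src_def open_tgt_def)
  have "open_src (Suc k) ?R = open_src k R - {a}" "open_tgt (Suc k) ?R = open_tgt k R - {e}"
    unfolding open_src_extension open_tgt_extension using less range Suc_notin_open by auto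
  then have cut: "{i \<in> open_src (Suc k) ?R. i < a} = {i \<in> open_src k R. i < a}"
    "{i \<in> open_src (Suc k) ?R. a < i} = {i \<in> open_src k R. a < i}"
    "{i \<in> open_tgt (Suc k) ?R. i < e} = {i \<in> open_tgt k R. i < e}"
    "{i \<in> open_tgt (Suc k) ?R. e < i \<and> i < Suc k} = {i \<in> open_tgt k R. e < i}"
    using less open_less by auto
  have arcs: "{j. (j, Suc k) \<in> ?R \<and> j \<le> Suc k} = {a}"
    "{j. (Suc k, j) \<in> ?R \<and> j < Suc k} = {e}"
    using partial_perms_notin less by auto
  have vertex: "vertex_weight u v w y (Suc k) ?R = 1"
    unfolding vertex_weight_def using partial_perms_notin less by auto
  show ?thesis
    unfolding step_def nest_at_def cros_at_def vertex arcs sum_singleton sum.empty cut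
    by (simp add: power_add mult.commute mult.left_commute)
qed

text \<open>\<open>R\<close> is a bijection from its domain to its range. The common number of open
  sources and open targets is the height of the Motzkin path.\<close>

lemma card_open_partial_perms: "card (open_src k R) = k - card R" "card (open_tgt k R) = k - card R"
proof -
  have sub: "R \<subseteq> {1..k} \<times> {1..k}" using R by (simp add: partial_perms_def)
  have fin: "finite R" using sub by (rule finite_subset) simp
  have "open_src k R = {1..k} - fst ` R" "open_tgt k R = {1..k} - snd ` R"
    using sub by (force simp: open_src_def open_tgt_def)+
  moreover have "fst ` R \<subseteq> {1..k}" "snd ` R \<subseteq> {1..k}" using sub by auto
  moreover have "card (fst ` R) = card R" "card (snd ` R) = card R"
    using R by (auto simp: partial_perms_def single_valued_def inj_on_def intro!: card_image)
  ultimately show "card (open_src k R) = k - card R" "card (open_tgt k R) = k - card R"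
    using fin by (simp_all add: card_Diff_subset)
qed

lemma card_partial_perms_le: "card R \<le> k"
proof -
  have "card R = card (fst ` R)"
    using R by (auto simp: partial_perms_def single_valued_def inj_on_def intro!: card_image[symmetric])
  also have "\<dots> \<le> card {1..k}"
    using R by (intro card_mono) (auto simp: partial_perms_def)
  finally show ?thesis by simp
qed

end

section \<open>\<open>(p, q)\<close>-integers and the Motzkin recurrence\<close>

text \<open>The \<open>(p, q)\<close>-integer \<open>(p^h - q^h) / (p - q)\<close>, written without
  division so that it makes sense in any commutative ring.\<close>

definition pq_integer :: "'a \<Rightarrow> 'a \<Rightarrow> nat \<Rightarrow> 'a::comm_ring_1" where
  "pq_integer p q h = (\<Sum>i<h. p ^ i * q ^ (h - 1 - i))"

lemma pq_integer_Suc: "pq_integer p q (Suc h) = p ^ h + q * pq_integer p q h"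
proof -
  have "p ^ i * q ^ (h - i) = q * (p ^ i * q ^ (h - 1 - i))" if "i < h" for i
  proof -
    have "h - i = Suc (h - 1 - i)" using that by simp
    then show ?thesis by (simp add: mult.left_commute)
  qed
  then show ?thesis by (simp add: pq_integer_def sum_distrib_left add.commute)
qed

text \<open>An element with \<open>i\<close> smaller ones in a set of size \<open>h\<close>
  contributes \<open>p^i q^(h-1-i)\<close>. In the induction a new maximum multiplies the old terms
  by \<open>q\<close> and adds \<open>p^h\<close>.\<close>

lemma sum_rank_weights:
  fixes A :: "nat set"
  assumes "finite A"
  shows "(\<Sum>a\<in>A. p ^ card {i \<in> A. i < a} * q ^ card {i \<in> A. a < i}) = pq_integer p q (card A)"
  using assms
proof (induction A rule: finite_linorder_max_induct)
  case empty
  show ?case by (simp add: pq_integer_def)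
next
  case (insert m A)
  have "m \<notin> A" using insert.hyps by auto
  have "{i \<in> insert m A. i < a} = {i \<in> A. i < a}"
    "card {i \<in> insert m A. a < i} = Suc (card {i \<in> A. a < i})" if "a \<in> A" for a
  proof -
    have "{i \<in> insert m A. a < i} = insert m {i \<in> A. a < i}"
      using that insert.hyps by auto
    then show "card {i \<in> insert m A. a < i} = Suc (card {i \<in> A. a < i})"
      using \<open>m \<notin> A\<close> insert.hyps by simp
  qed (use that insert.hyps in auto)
  then have "(\<Sum>a\<in>A. p ^ card {i \<in> insert m A. i < a} * q ^ card {i \<in> insert m A. a < i})
      = q * (\<Sum>a\<in>A. p ^ card {i \<in> A. i < a} * q ^ card {i \<in> A. a < i})"
    by (simp add: sum_distrib_left ac_simps)
  moreover have max: "{i \<in> insert m A. i < m} = A" "{i \<in> insert m A. m < i} = {}"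
    using insert.hyps by auto
  ultimately show ?case
    unfolding sum.insert[OF \<open>finite A\<close> \<open>m \<notin> A\<close>] max
    using insert.IH insert.hyps \<open>m \<notin> A\<close> by (simp add: pq_integer_Suc)
qed

text \<open>The total weight of Motzkin paths with \<open>m\<close> steps from height
  \<open>h\<close> down to \<open>0\<close>. At \<open>h = 0\<close> the truncated
  \<open>h - 1\<close> does no harm, since \<open>pq_integer p q 0 = 0\<close>.\<close>

fun motzkin :: "'a \<Rightarrow> 'a \<Rightarrow> 'a \<Rightarrow> 'a \<Rightarrow> 'a \<Rightarrow> nat \<Rightarrow> nat \<Rightarrow> 'a::comm_ring_1" where
  "motzkin p q c w y 0 h = (if h = 0 then 1 else 0)"
| "motzkin p q c w y (Suc m) h = w * motzkin p q c w y m (Suc h)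
     + (y * p ^ h + c * pq_integer p q h) * motzkin p q c w y m h
     + pq_integer p q h ^ 2 * motzkin p q c w y m (h - 1)"

lemma card_extension:
  assumes R: "R \<in> partial_perms k"
  shows "card (R \<union> {(Suc k, Suc k)}) = Suc (card R)"
    "a \<in> open_src k R \<Longrightarrow> card (R \<union> {(a, Suc k)}) = Suc (card R)"
    "e \<in> open_tgt k R \<Longrightarrow> card (R \<union> {(Suc k, e)}) = Suc (card R)"
    "a \<in> open_src k R \<Longrightarrow> e \<in> open_tgt k R \<Longrightarrow>
      card (R \<union> {(a, Suc k), (Suc k, e)}) = Suc (Suc (card R))"
proof -
  have fin: "finite R"
    by (rule finite_subset[of _ "{1..k} \<times> {1..k}"]) (use R in \<open>auto simp: partial_perms_def\<close>)
  show "card (R \<union> {(Suc k, Suc k)}) = Suc (card R)"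
    "a \<in> open_src k R \<Longrightarrow> card (R \<union> {(a, Suc k)}) = Suc (card R)"
    "e \<in> open_tgt k R \<Longrightarrow> card (R \<union> {(Suc k, e)}) = Suc (card R)"
    "a \<in> open_src k R \<Longrightarrow> e \<in> open_tgt k R \<Longrightarrow>
      card (R \<union> {(a, Suc k), (Suc k, e)}) = Suc (Suc (card R))"
    using fin partial_perms_notin[OF R] Suc_notin_open by (auto simp: card_insert_if)
qed

text \<open>With \<open>h = k - card R\<close>, the five shapes lead to heights
  \<open>h + 1\<close>, \<open>h\<close>, \<open>h\<close>, \<open>h\<close>, \<open>h - 1\<close>.
  Double ascents and double descents both carry \<open>pq_integer p q h\<close> and stay at
  \<open>h\<close>, which merges \<open>u\<close> and \<open>v\<close> into
  \<open>q * u + v\<close>.\<close>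

lemma sum_extensions_motzkin:
  fixes p q u v w y :: "'a::comm_ring_1"
  assumes R: "R \<in> partial_perms k"
  shows "(\<Sum>X\<in>extensions k R. step p q u v w y (Suc k) (R \<union> X)
      * motzkin p q (q * u + v) w y m (Suc k - card (R \<union> X)))
    = motzkin p q (q * u + v) w y (Suc m) (k - card R)"
proof -
  define h where "h = k - card R"
  let ?M = "motzkin p q (q * u + v) w y m"
  have h: "Suc k - card R = Suc h" "Suc k - Suc (card R) = h" "Suc k - Suc (Suc (card R)) = h - 1"
    \<comment> \<open>The first identity rests on \<open>card R \<le> k\<close>; the last one
      truncates at \<open>h = 0\<close> just as \<open>motzkin\<close> does.\<close>
    using card_partial_perms_le[OF R] by (auto simp: h_def)
  note ranks = sum_rank_weights[OF finite_open_src, of p k R q, unfolded card_open_partial_perms(1)[OF R], folded h_def]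
    sum_rank_weights[OF finite_open_tgt, of p k R q, unfolded card_open_partial_perms(2)[OF R], folded h_def]
  let ?S = "\<lambda>X. step p q u v w y (Suc k) (R \<union> X) * ?M (Suc k - card (R \<union> X))"
  have 1: "?S {} = w * ?M (Suc h)"
    unfolding step_opener[OF R] by (simp add: h)
  have 2: "?S {(Suc k, Suc k)} = y * p ^ h * ?M h"
    unfolding step_fixed[OF R] card_extension(1)[OF R] h card_open_partial_perms[OF R] h_def[symmetric] ..
  have 3: "(\<Sum>a\<in>open_src k R. ?S {(a, Suc k)}) = q * u * pq_integer p q h * ?M h"
    unfolding ranks(1)[symmetric]
    by (simp add: step_source[OF R] card_extension[OF R] h sum_distrib_left sum_distrib_right
        del: Un_insert_right diff_Suc_Suc)
  have 4: "(\<Sum>e\<in>open_tgt k R. ?S {(Suc k, e)}) = v * pq_integer p q h * ?M h"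
    unfolding ranks(2)[symmetric]
    by (simp add: step_target[OF R] card_extension[OF R] h sum_distrib_left sum_distrib_right
        del: Un_insert_right diff_Suc_Suc)
  have 5: "(\<Sum>a\<in>open_src k R. \<Sum>e\<in>open_tgt k R. ?S {(a, Suc k), (Suc k, e)})
      = pq_integer p q h * pq_integer p q h * ?M (h - 1)"
  proof -
    have "pq_integer p q h * pq_integer p q h = (\<Sum>a\<in>open_src k R. \<Sum>e\<in>open_tgt k R.
        (p ^ card {i \<in> open_src k R. i < a} * q ^ card {i \<in> open_src k R. a < i})
        * (p ^ card {i \<in> open_tgt k R. i < e} * q ^ card {i \<in> open_tgt k R. e < i}))"
      by (simp only: ranks sum_product[symmetric])
    then show ?thesis
      by (simp add: step_source_target[OF R] card_extension[OF R] h sum_distrib_right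
          del: Un_insert_right diff_Suc_Suc)
  qed
  show ?thesis
    unfolding sum_extensions 1 2 3 4 5 h_def[symmetric] by (simp add: algebra_simps power2_eq_square)
qed

text \<open>An invariant of the scan: scanned parts are weighted by all ways to complete the path
  from their height. One induction step moves a point from the \<open>m\<close> remaining to the
  \<open>k\<close> scanned, so \<open>m\<close> must vary.\<close>

lemma sum_partial_perms_motzkin:
  fixes p q u v w y :: "'a::comm_ring_1"
  shows "(\<Sum>R\<in>partial_perms k. weight p q u v w y k R * motzkin p q (q * u + v) w y m (k - card R))
    = motzkin p q (q * u + v) w y (k + m) 0"
proof (induction k arbitrary: m)
  case 0
  have "partial_perms 0 = {{}}" by (auto simp: partial_perms_def single_valued_def)
  then show ?case by (simp add: weight_def)
next
  case (Suc k)
  show ?case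
    unfolding sum_partial_perms_Suc
    using Suc[of "Suc m"]
    by (simp add: weight_extension sum_extensions_motzkin mult.assoc sum_distrib_left[symmetric]
        del: motzkin.simps)
qed

section \<open>Permutations as partial permutations without open points\<close>

definition graph :: "nat \<Rightarrow> (nat \<Rightarrow> nat) \<Rightarrow> (nat \<times> nat) set" where
  "graph n \<sigma> = (\<lambda>i. (i, \<sigma> i)) ` {1..n}"

lemma mem_graph: "(i, j) \<in> graph n \<sigma> \<longleftrightarrow> i \<in> {1..n} \<and> j = \<sigma> i"
  by (auto simp: graph_def)

text \<open>For surjectivity: \<open>n\<close> pairs with distinct sources in \<open>{1..n}\<close>
  use every source, so the relation is the graph of an injective self-map of a finite set.\<close>

lemma bij_betw_graph: "bij_betw (graph n) (perms n) {R \<in> partial_perms n. card R = n}"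
proof (rule bij_betwI')
  fix \<sigma> \<tau> assume \<sigma>: "\<sigma> \<in> perms n" and \<tau>: "\<tau> \<in> perms n"
  show "graph n \<sigma> = graph n \<tau> \<longleftrightarrow> \<sigma> = \<tau>"
  proof
    assume eq: "graph n \<sigma> = graph n \<tau>"
    show "\<sigma> = \<tau>"
    proof
      fix i
      show "\<sigma> i = \<tau> i"
      proof (cases "i \<in> {1..n}")
        case True
        then have "(i, \<sigma> i) \<in> graph n \<tau>" using eq mem_graph by metis
        then show ?thesis by (simp add: mem_graph)
      next
        case False
        then show ?thesis
          using \<sigma> \<tau> by (metis perms_def mem_Collect_eq permutes_not_in)
      qed
    qed
  qed simp
next
  fix \<sigma> assume "\<sigma> \<in> perms n"
  then have \<sigma>: "\<sigma> permutes {1..n}" by (simp add: perms_def)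
  have "graph n \<sigma> \<subseteq> {1..n} \<times> {1..n}"
    unfolding graph_def using permutes_in_image[OF \<sigma>] by blast
  moreover have "single_valued (graph n \<sigma>)" "single_valued ((graph n \<sigma>)\<inverse>)"
    by (auto simp: single_valued_def mem_graph inj_eq[OF permutes_inj[OF \<sigma>]])
  moreover have "card (graph n \<sigma>) = n"
    by (simp add: graph_def card_image inj_on_def)
  ultimately show "graph n \<sigma> \<in> {R \<in> partial_perms n. card R = n}"
    by (simp add: partial_perms_def)
next
  fix R assume "R \<in> {R \<in> partial_perms n. card R = n}"
  then have sub: "R \<subseteq> {1..n} \<times> {1..n}" and card: "card R = n"
    and fn: "\<And>i j j'. (i, j) \<in> R \<Longrightarrow> (i, j') \<in> R \<Longrightarrow> j = j'"
    and inj: "\<And>i i' j. (i, j) \<in> R \<Longrightarrow> (i', j) \<in> R \<Longrightarrow> i = i'"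
    by (auto simp: partial_perms_def single_valued_def)
  have "card (fst ` R) = n"
    unfolding card[symmetric] by (rule card_image) (use fn in \<open>auto simp: inj_on_def\<close>)
  moreover have "fst ` R \<subseteq> {1..n}" using sub by auto
  ultimately have dom: "fst ` R = {1..n}" by (simp add: card_subset_eq)
  \<comment> \<open>\<open>permutes\<close> requires the identity outside
    \<open>{1..n}\<close>.\<close>
  define \<sigma> where "\<sigma> i = (if i \<in> {1..n} then THE j. (i, j) \<in> R else i)" for i
  have mem: "(i, \<sigma> i) \<in> R" if i: "i \<in> {1..n}" for i
  proof -
    obtain j where "(i, j) \<in> R" using i dom by (metis imageE prod.collapse)
    then have "\<exists>!j. (i, j) \<in> R" using fn by blast
    from theI'[OF this] show ?thesis using i by (simp add: \<sigma>_def)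
  qed
  have inj_\<sigma>: "inj_on \<sigma> {1..n}"
    by (rule inj_onI) (metis inj mem)
  have "\<sigma> ` {1..n} \<subseteq> {1..n}" using mem sub by blast
  then have "\<sigma> ` {1..n} = {1..n}" using inj_\<sigma> by (simp add: endo_inj_surj)
  then have "bij_betw \<sigma> {1..n} {1..n}"
    using inj_\<sigma> by (simp only: bij_betw_def)
  then have "\<sigma> permutes {1..n}"
    by (rule bij_imp_permutes) (simp only: \<sigma>_def if_False)
  moreover have "R = graph n \<sigma>"
  proof (intro set_eqI, clarify)
    fix i j
    have "i \<in> {1..n}" if "(i, j) \<in> R" using sub that by blast
    then show "(i, j) \<in> R \<longleftrightarrow> (i, j) \<in> graph n \<sigma>"
      unfolding mem_graph using mem[of i] fn[of i j] by metis
  qed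
  ultimately show "\<exists>\<sigma>\<in>perms n. R = graph n \<sigma>" by (auto simp: perms_def)
qed

text \<open>With no steps remaining, \<open>motzkin\<close> is the indicator of height
  \<open>0\<close>, which selects the partial permutations with \<open>n\<close> pairs. The
  right-hand side sees \<open>u\<close> and \<open>v\<close> only through
  \<open>q * u + v\<close>.\<close>

lemma sum_weight_graph:
  fixes p q u v w y :: "'a::comm_ring_1"
  shows "(\<Sum>\<sigma>\<in>perms n. weight p q u v w y n (graph n \<sigma>)) = motzkin p q (q * u + v) w y n 0"
proof -
  have full: "n \<le> card R \<longleftrightarrow> card R = n" if "R \<in> partial_perms n" for R
    using card_partial_perms_le[OF that] by auto
  have "(\<Sum>\<sigma>\<in>perms n. weight p q u v w y n (graph n \<sigma>))
      = (\<Sum>R | R \<in> partial_perms n \<and> card R = n. weight p q u v w y n R)"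
    by (rule sum.reindex_bij_betw[OF bij_betw_graph])
  also have "\<dots> = (\<Sum>R\<in>partial_perms n. if card R = n then weight p q u v w y n R else 0)"
    by (rule sum.inter_filter[OF finite_partial_perms])
  also have "\<dots> = (\<Sum>R\<in>partial_perms n.
      weight p q u v w y n R * motzkin p q (q * u + v) w y 0 (n - card R))"
    by (intro sum.cong refl) (simp add: full)
  also have "\<dots> = motzkin p q (q * u + v) w y n 0"
    using sum_partial_perms_motzkin[of p q u v w y n 0] by simp
  finally show ?thesis .
qed

section \<open>Local counts summed to the permutation statistics\<close>

lemma card_pairs:
  assumes "finite A"
  shows "card {(i, j) \<in> A \<times> A. Q i j} = (\<Sum>i\<in>A. card {j \<in> A. Q i j})"
proof -
  have "{(i, j) \<in> A \<times> A. Q i j} = (SIGMA i:A. {j \<in> A. Q i j})" by auto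
  then show ?thesis using assms by simp
qed

lemma card_pairs':
  assumes "finite A"
  shows "card {(i, j) \<in> A \<times> A. Q i j} = (\<Sum>j\<in>A. card {i \<in> A. Q i j})"
proof -
  have "bij_betw prod.swap {(i, j) \<in> A \<times> A. Q i j} {(j, i) \<in> A \<times> A. Q i j}"
    by (rule bij_betw_byWitness[where f' = prod.swap]) auto
  then have "card {(i, j) \<in> A \<times> A. Q i j} = card {(j, i) \<in> A \<times> A. Q i j}"
    by (rule bij_betw_same_card)
  then show ?thesis using card_pairs[OF assms, of "\<lambda>j i. Q i j"] by simp
qed

context
  fixes n :: nat and \<sigma> :: "nat \<Rightarrow> nat"
  assumes \<sigma>: "\<sigma> permutes {1..n}"
begin

lemma permutes_image_in: "i \<in> {1..n} \<Longrightarrow> \<sigma> i \<in> {1..n}"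
  using permutes_in_image[OF \<sigma>] by blast

lemma permutes_inv_image_in: "i \<in> {1..n} \<Longrightarrow> inv \<sigma> i \<in> {1..n}"
  using permutes_in_image[OF permutes_inv[OF \<sigma>]] by blast

lemma graph_sources:
  assumes "j \<in> {1..n}"
  shows "{i. (i, \<sigma> j) \<in> graph n \<sigma> \<and> i \<le> \<sigma> j} = (if j \<le> \<sigma> j then {j} else {})"
  using assms by (auto simp: mem_graph inj_eq[OF permutes_inj[OF \<sigma>]])

lemma graph_targets:
  assumes "j \<in> {1..n}"
  shows "{i. (j, i) \<in> graph n \<sigma> \<and> i < j} = (if \<sigma> j < j then {\<sigma> j} else {})"
  using assms by (auto simp: mem_graph)

lemma open_src_graph:
  assumes "j \<in> {1..n}"
  shows "open_src j (graph n \<sigma>) = {i \<in> {1..n}. i \<le> j \<and> j < \<sigma> i}"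
proof -
  have "(\<forall>x\<in>{1..j}. (i, x) \<notin> graph n \<sigma>) \<longleftrightarrow> j < \<sigma> i" if "i \<in> {1..n}" for i
    using permutes_image_in[OF that] that by (auto simp: mem_graph)
  then show ?thesis using assms by (auto simp: open_src_def)
qed

text \<open>The image form turns counts of open targets into counts of their preimages, the indices
  used in \<open>nest\<close> and \<open>cros\<close>.\<close>

lemma open_tgt_graph:
  assumes "j \<in> {1..n}"
  shows "open_tgt j (graph n \<sigma>) = \<sigma> ` {i \<in> {1..n}. j < i \<and> \<sigma> i \<le> j}"
proof (intro equalityI subsetI)
  fix e assume e: "e \<in> open_tgt j (graph n \<sigma>)"
  then have "e \<in> {1..n}" using assms by (auto simp: open_tgt_def)
  then obtain i where i: "i \<in> {1..n}" "\<sigma> i = e" using permutes_image[OF \<sigma>] by (metis imageE)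
  then have "(i, e) \<in> graph n \<sigma>" by (simp add: mem_graph)
  then have "i \<notin> {1..j}" using e by (auto simp: open_tgt_def)
  then show "e \<in> \<sigma> ` {i \<in> {1..n}. j < i \<and> \<sigma> i \<le> j}"
    using e i by (auto simp: open_tgt_def)
next
  fix e assume "e \<in> \<sigma> ` {i \<in> {1..n}. j < i \<and> \<sigma> i \<le> j}"
  then obtain i where i: "i \<in> {1..n}" "j < i" "\<sigma> i \<le> j" "e = \<sigma> i" by blast
  then have "(x, e) \<notin> graph n \<sigma>" if "x \<in> {1..j}" for x
    using that by (auto simp: mem_graph inj_eq[OF permutes_inj[OF \<sigma>]])
  then show "e \<in> open_tgt j (graph n \<sigma>)"
    using permutes_image_in[OF i(1)] i by (auto simp: open_tgt_def)
qed

lemma card_open_tgt_graph: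
  assumes "j \<in> {1..n}"
  shows "card {e \<in> open_tgt j (graph n \<sigma>). P e} = card {i \<in> {1..n}. j < i \<and> \<sigma> i \<le> j \<and> P (\<sigma> i)}"
proof -
  have "{e \<in> open_tgt j (graph n \<sigma>). P e} = \<sigma> ` {i \<in> {1..n}. j < i \<and> \<sigma> i \<le> j \<and> P (\<sigma> i)}"
    unfolding open_tgt_graph[OF assms] by auto
  then show ?thesis by (simp add: card_image permutes_inj_on[OF \<sigma>])
qed

text \<open>In both alternatives of \<open>nest\<close> the inner arc starts at \<open>j\<close>, so
  a single count with \<open>j\<close> fixed covers upper and lower nestings.\<close>

lemma sum_nest_at: "(\<Sum>x=1..n. nest_at x (graph n \<sigma>)) = nest n \<sigma>"
proof -
  let ?G = "graph n \<sigma>"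
  \<comment> \<open>Upper arcs are recorded at their target; substituting \<open>\<sigma> x\<close>
    for \<open>x\<close> indexes them by their source.\<close>
  have "(\<Sum>x=1..n. \<Sum>j | (j, x) \<in> ?G \<and> j \<le> x. card {i \<in> open_src x ?G. i < j})
      = (\<Sum>x=1..n. \<Sum>j | (j, \<sigma> x) \<in> ?G \<and> j \<le> \<sigma> x. card {i \<in> open_src (\<sigma> x) ?G. i < j})"
    by (rule sum.reindex_bij_betw[OF permutes_imp_bij[OF \<sigma>], symmetric])
  also have "\<dots> = (\<Sum>x=1..n. if x \<le> \<sigma> x then card {i \<in> open_src (\<sigma> x) ?G. i < x} else 0)"
    by (intro sum.cong refl) (simp add: graph_sources)
  finally have src: "(\<Sum>x=1..n. \<Sum>j | (j, x) \<in> ?G \<and> j \<le> x. card {i \<in> open_src x ?G. i < j}) = \<dots>" .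
  have tgt: "(\<Sum>x=1..n. \<Sum>j | (x, j) \<in> ?G \<and> j < x. card {i \<in> open_tgt x ?G. i < j})
      = (\<Sum>x=1..n. if \<sigma> x < x then card {i \<in> open_tgt x ?G. i < \<sigma> x} else 0)"
    by (intro sum.cong refl) (simp add: graph_targets)
  have pt: "(if x \<le> \<sigma> x then card {i \<in> open_src (\<sigma> x) ?G. i < x} else 0)
      + (if \<sigma> x < x then card {i \<in> open_tgt x ?G. i < \<sigma> x} else 0)
      = card {i \<in> {1..n}. i < x \<and> x \<le> \<sigma> x \<and> \<sigma> x < \<sigma> i \<or> i > x \<and> x > \<sigma> x \<and> \<sigma> x > \<sigma> i}"
    if x: "x \<in> {1..n}" for x
  proof (cases "x \<le> \<sigma> x")
    case True
    then have "{i \<in> open_src (\<sigma> x) ?G. i < x} =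
      {i \<in> {1..n}. i < x \<and> x \<le> \<sigma> x \<and> \<sigma> x < \<sigma> i \<or> i > x \<and> x > \<sigma> x \<and> \<sigma> x > \<sigma> i}"
      unfolding open_src_graph[OF permutes_image_in[OF x]] by auto
    with True show ?thesis by simp
  next
    case False
    then have "{i \<in> {1..n}. x < i \<and> \<sigma> i \<le> x \<and> \<sigma> i < \<sigma> x} =
      {i \<in> {1..n}. i < x \<and> x \<le> \<sigma> x \<and> \<sigma> x < \<sigma> i \<or> i > x \<and> x > \<sigma> x \<and> \<sigma> x > \<sigma> i}"
      by auto
    with False show ?thesis by (simp add: card_open_tgt_graph[OF x])
  qed
  show ?thesis
    unfolding nest_at_def sum.distrib src tgt nest_def card_pairs'[OF finite_atLeastAtMost]
    unfolding sum.distrib[symmetric] using pt by (intro sum.cong refl) blast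
qed

text \<open>The arc closed first starts at \<open>i\<close> in an upper crossing but at
  \<open>j\<close> in a lower one. The two kinds are thus counted separately, with different
  components fixed, and added as disjoint sets.\<close>

lemma sum_cros_at: "(\<Sum>x=1..n. cros_at x (graph n \<sigma>)) = cros n \<sigma>"
proof -
  let ?G = "graph n \<sigma>"
  have "(\<Sum>x=1..n. \<Sum>j | (j, x) \<in> ?G \<and> j \<le> x. card {i \<in> open_src x ?G. j < i})
      = (\<Sum>x=1..n. \<Sum>j | (j, \<sigma> x) \<in> ?G \<and> j \<le> \<sigma> x. card {i \<in> open_src (\<sigma> x) ?G. j < i})"
    by (rule sum.reindex_bij_betw[OF permutes_imp_bij[OF \<sigma>], symmetric])
  also have "\<dots> = (\<Sum>i=1..n. card {j \<in> {1..n}. i < j \<and> j \<le> \<sigma> i \<and> \<sigma> i < \<sigma> j})"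
  proof (intro sum.cong refl)
    fix x assume x: "x \<in> {1..n}"
    have eq: "{i \<in> open_src (\<sigma> x) ?G. x < i} = {j \<in> {1..n}. x < j \<and> j \<le> \<sigma> x \<and> \<sigma> x < \<sigma> j}"
      unfolding open_src_graph[OF permutes_image_in[OF x]] by auto
    have none: "card {j \<in> {1..n}. x < j \<and> j \<le> \<sigma> x \<and> \<sigma> x < \<sigma> j} = 0" if "\<not> x \<le> \<sigma> x"
      using that by (auto simp: card_eq_0_iff)
    show "(\<Sum>j | (j, \<sigma> x) \<in> ?G \<and> j \<le> \<sigma> x. card {i \<in> open_src (\<sigma> x) ?G. j < i})
        = card {j \<in> {1..n}. x < j \<and> j \<le> \<sigma> x \<and> \<sigma> x < \<sigma> j}"
      unfolding graph_sources[OF x]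
      by (cases "x \<le> \<sigma> x") (simp_all only: if_True if_False sum_singleton sum.empty eq none not_False_eq_True)
  qed
  also have "\<dots> = card {(i, j) \<in> {1..n} \<times> {1..n}. i < j \<and> j \<le> \<sigma> i \<and> \<sigma> i < \<sigma> j}"
    by (rule card_pairs[symmetric]) simp
  finally have src: "(\<Sum>x=1..n. \<Sum>j | (j, x) \<in> ?G \<and> j \<le> x. card {i \<in> open_src x ?G. j < i}) = \<dots>" .
  have "(\<Sum>x=1..n. \<Sum>j | (x, j) \<in> ?G \<and> j < x. card {i \<in> open_tgt x ?G. j < i \<and> i < x})
      = (\<Sum>j=1..n. card {i \<in> {1..n}. i > j \<and> j > \<sigma> i \<and> \<sigma> i > \<sigma> j})"
  proof (intro sum.cong refl)
    fix x assume x: "x \<in> {1..n}"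
    have "{i \<in> {1..n}. x < i \<and> \<sigma> i \<le> x \<and> \<sigma> x < \<sigma> i \<and> \<sigma> i < x}
        = {i \<in> {1..n}. i > x \<and> x > \<sigma> i \<and> \<sigma> i > \<sigma> x}"
      by auto
    then have eq: "card {i \<in> open_tgt x ?G. \<sigma> x < i \<and> i < x}
        = card {i \<in> {1..n}. i > x \<and> x > \<sigma> i \<and> \<sigma> i > \<sigma> x}"
      unfolding card_open_tgt_graph[OF x] by (rule arg_cong)
    have none: "card {i \<in> {1..n}. i > x \<and> x > \<sigma> i \<and> \<sigma> i > \<sigma> x} = 0" if "\<not> \<sigma> x < x"
      using that by (auto simp: card_eq_0_iff)
    show "(\<Sum>j | (x, j) \<in> ?G \<and> j < x. card {i \<in> open_tgt x ?G. j < i \<and> i < x})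
        = card {i \<in> {1..n}. i > x \<and> x > \<sigma> i \<and> \<sigma> i > \<sigma> x}"
      unfolding graph_targets[OF x]
      by (cases "\<sigma> x < x") (simp_all only: if_True if_False sum_singleton sum.empty eq none not_False_eq_True)
  qed
  also have "\<dots> = card {(i, j) \<in> {1..n} \<times> {1..n}. i > j \<and> j > \<sigma> i \<and> \<sigma> i > \<sigma> j}"
    by (rule card_pairs'[symmetric]) simp
  finally have tgt: "(\<Sum>x=1..n. \<Sum>j | (x, j) \<in> ?G \<and> j < x.
      card {i \<in> open_tgt x ?G. j < i \<and> i < x}) = \<dots>" .
  have fin: "finite {(i, j) \<in> {1..n} \<times> {1..n}. Q i j}" for Q
    by (rule finite_subset[of _ "{1..n} \<times> {1..n}"]) auto
  have "card ({(i, j) \<in> {1..n} \<times> {1..n}. i < j \<and> j \<le> \<sigma> i \<and> \<sigma> i < \<sigma> j}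
      \<union> {(i, j) \<in> {1..n} \<times> {1..n}. i > j \<and> j > \<sigma> i \<and> \<sigma> i > \<sigma> j})
      = card {(i, j) \<in> {1..n} \<times> {1..n}. i < j \<and> j \<le> \<sigma> i \<and> \<sigma> i < \<sigma> j}
      + card {(i, j) \<in> {1..n} \<times> {1..n}. i > j \<and> j > \<sigma> i \<and> \<sigma> i > \<sigma> j}"
    by (rule card_Un_disjoint, rule fin, rule fin) auto
  also have "{(i, j) \<in> {1..n} \<times> {1..n}. i < j \<and> j \<le> \<sigma> i \<and> \<sigma> i < \<sigma> j}
      \<union> {(i, j) \<in> {1..n} \<times> {1..n}. i > j \<and> j > \<sigma> i \<and> \<sigma> i > \<sigma> j}
      = {(i, j) \<in> {1..n} \<times> {1..n}. (i < j \<and> j \<le> \<sigma> i \<and> \<sigma> i < \<sigma> j) \<or> (i > j \<and> j > \<sigma> i \<and> \<sigma> i > \<sigma> j)}"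
    by auto
  finally show ?thesis
    unfolding cros_at_def sum.distrib src tgt cros_def by (rule sym)
qed

text \<open>Exponents \<open>0\<close> and \<open>1\<close> let the product over \<open>x\<close>
  become powers of cardinalities. At a cyclic peak all four exponents are \<open>0\<close>.\<close>

lemma vertex_weight_graph:
  assumes x: "x \<in> {1..n}"
  shows "vertex_weight u v w y x (graph n \<sigma>) = u ^ of_bool (inv \<sigma> x < x \<and> x < \<sigma> x)
    * v ^ of_bool (inv \<sigma> x > x \<and> x > \<sigma> x) * w ^ of_bool (inv \<sigma> x > x \<and> x < \<sigma> x)
    * y ^ of_bool (\<sigma> x = x)"
proof -
  have inv: "\<sigma> i = x \<longleftrightarrow> i = inv \<sigma> x" for i
    using permutes_inverses[OF \<sigma>] by metis
  have "(i, x) \<in> graph n \<sigma> \<longleftrightarrow> i = inv \<sigma> x" "(x, i) \<in> graph n \<sigma> \<longleftrightarrow> i = \<sigma> x" for i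
    unfolding mem_graph using inv[of i] permutes_inv_image_in[OF x] x by metis+
  then have "(x, x) \<in> graph n \<sigma> \<longleftrightarrow> x = \<sigma> x" "(\<exists>i<x. (i, x) \<in> graph n \<sigma>) \<longleftrightarrow> inv \<sigma> x < x"
    "(\<exists>i<x. (x, i) \<in> graph n \<sigma>) \<longleftrightarrow> \<sigma> x < x"
    by metis+
  moreover have "inv \<sigma> x = x \<longleftrightarrow> x = \<sigma> x" using inv[of x] by metis
  ultimately show ?thesis
    by (auto simp: vertex_weight_def)
qed

lemma weight_graph:
  "weight p q u v w y n (graph n \<sigma>) = p ^ nest n \<sigma> * q ^ cros n \<sigma>
    * (u ^ cda n \<sigma> * v ^ cdd n \<sigma> * w ^ cvalley n \<sigma> * y ^ fixpts n \<sigma>)"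
proof -
  have count: "(\<Prod>x=1..n. c ^ of_bool (P x)) = c ^ card {x \<in> {1..n}. P x}" for c :: 'a and P
    by (simp add: power_sum[symmetric] Int_def)
  have "(\<Prod>x=1..n. vertex_weight u v w y x (graph n \<sigma>))
      = u ^ cda n \<sigma> * v ^ cdd n \<sigma> * w ^ cvalley n \<sigma> * y ^ fixpts n \<sigma>"
    by (simp only: vertex_weight_graph prod.distrib count cda_def cdd_def cvalley_def fixpts_def cong: prod.cong)
  then show ?thesis
    unfolding weight_def step_def prod.distrib power_sum[symmetric] sum_nest_at sum_cros_at by simp
qed

text \<open>\<open>\<sigma>\<close> sends the positions of drops to their values, the points
  \<open>x\<close> with \<open>x < inv \<sigma> x\<close>; none of these is fixed, so each is a
  cyclic valley or a double descent.\<close>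

lemma drops_eq_cvalley_cdd: "drops n \<sigma> = cvalley n \<sigma> + cdd n \<sigma>"
proof -
  have inv: "\<sigma> x = x \<longleftrightarrow> inv \<sigma> x = x" for x
    using permutes_inverses[OF \<sigma>] by metis
  have "x < inv \<sigma> x \<longleftrightarrow> inv \<sigma> x > x \<and> x < \<sigma> x \<or> inv \<sigma> x > x \<and> x > \<sigma> x" for x
    using inv[of x] by (cases x "\<sigma> x" rule: linorder_cases) auto
  then have split: "{x \<in> {1..n}. x < inv \<sigma> x} =
      {x \<in> {1..n}. inv \<sigma> x > x \<and> x < \<sigma> x} \<union> {x \<in> {1..n}. inv \<sigma> x > x \<and> x > \<sigma> x}"
    by blast
  have "bij_betw \<sigma> {i \<in> {1..n}. i > \<sigma> i} {x \<in> {1..n}. x < inv \<sigma> x}"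
  proof (rule bij_betwI[where g = "inv \<sigma>"])
    show "\<sigma> \<in> {i \<in> {1..n}. i > \<sigma> i} \<rightarrow> {x \<in> {1..n}. x < inv \<sigma> x}"
      using permutes_image_in permutes_inverses[OF \<sigma>] by auto
    show "inv \<sigma> \<in> {x \<in> {1..n}. x < inv \<sigma> x} \<rightarrow> {i \<in> {1..n}. i > \<sigma> i}"
      using permutes_inv_image_in permutes_inverses[OF \<sigma>] by auto
  qed (simp_all add: permutes_inverses[OF \<sigma>])
  then have "drops n \<sigma> = card {x \<in> {1..n}. x < inv \<sigma> x}"
    unfolding drops_def by (rule bij_betw_same_card)
  also have "\<dots> = cvalley n \<sigma> + cdd n \<sigma>"
    unfolding split cvalley_def cdd_def by (rule card_Un_disjoint) auto
  finally show ?thesis .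
qed

text \<open>The points split into fixed points, drops, cyclic valleys and double ascents. By
  \<open>drops_eq_cvalley_cdd\<close> the drops supply the second copy of
  \<open>cvalley\<close>.\<close>

lemma fixpts_cvalley_cda_cdd: "fixpts n \<sigma> + 2 * cvalley n \<sigma> + cda n \<sigma> + cdd n \<sigma> = n"
proof -
  have inv: "\<sigma> x = x \<longleftrightarrow> inv \<sigma> x = x" for x
    using permutes_inverses[OF \<sigma>] by metis
  let ?A = "{x \<in> {1..n}. \<sigma> x = x}" and ?B = "{x \<in> {1..n}. x > \<sigma> x}"
    and ?C = "{x \<in> {1..n}. inv \<sigma> x > x \<and> x < \<sigma> x}" and ?D = "{x \<in> {1..n}. inv \<sigma> x < x \<and> x < \<sigma> x}"
  have "\<sigma> x = x \<or> x > \<sigma> x \<or> inv \<sigma> x > x \<and> x < \<sigma> x \<or> inv \<sigma> x < x \<and> x < \<sigma> x" for x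
    using inv[of x] by (cases x "\<sigma> x" rule: linorder_cases; cases x "inv \<sigma> x" rule: linorder_cases) auto
  then have parts: "{1..n} = (?A \<union> ?B) \<union> (?C \<union> ?D)"
    by blast
  have "n = card {1..n}" by simp
  also have "\<dots> = card ((?A \<union> ?B) \<union> (?C \<union> ?D))"
    using parts by (rule arg_cong)
  also have "\<dots> = card (?A \<union> ?B) + card (?C \<union> ?D)"
    by (rule card_Un_disjoint) auto
  also have "card (?A \<union> ?B) = fixpts n \<sigma> + drops n \<sigma>"
    unfolding fixpts_def drops_def by (rule card_Un_disjoint) auto
  also have "card (?C \<union> ?D) = cvalley n \<sigma> + cda n \<sigma>"
    unfolding cvalley_def cda_def by (rule card_Un_disjoint) auto
  finally show ?thesis unfolding drops_eq_cvalley_cdd by linarith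
qed

end

section \<open>Expansion in powers of \<open>t * w\<close> and \<open>q * u + t * v\<close>\<close>

theorem theorem8:
  fixes n :: nat and p q t u v w y :: "'a::comm_ring_1"
  assumes "n \<ge> 1"
  shows "B n p q t u v w y =
    (\<Sum>j=0..n. y ^ j * (\<Sum>k=0..(n - j) div 2.
       b n k j p q * (t * w) ^ k * (q * u + t * v) ^ (n - j - 2 * k)))"
proof -
  let ?c = "q * u + t * v"
  let ?P = "\<lambda>j k. {\<sigma> \<in> perms n. cvalley n \<sigma> = k \<and> fixpts n \<sigma> = j \<and> cda n \<sigma> = 0}"
  have perm: "\<sigma> permutes {1..n}" if "\<sigma> \<in> perms n" for \<sigma>
    using that by (simp add: perms_def)
  \<comment> \<open>Each drop is charged to a cyclic valley or a double descent, so \<open>t\<close>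
    is absorbed into \<open>w\<close> and \<open>v\<close>.\<close>
  have "B n p q t u v w y = (\<Sum>\<sigma>\<in>perms n. weight p q u (t * v) (t * w) y n (graph n \<sigma>))"
    unfolding B_def
    by (intro sum.cong refl)
      (simp add: weight_graph[OF perm] drops_eq_cvalley_cdd[OF perm] power_add power_mult_distrib ac_simps)
  \<comment> \<open>Both sums equal the same \<open>motzkin\<close> value, because
    \<open>q * u + t * v = q * 0 + ?c\<close>.\<close>
  also have "\<dots> = (\<Sum>\<sigma>\<in>perms n. weight p q 0 ?c (t * w) y n (graph n \<sigma>))"
    by (simp add: sum_weight_graph)
  \<comment> \<open>With \<open>u\<close> replaced by \<open>0\<close>, only permutations without
    double ascents survive, and each of them lies in exactly one class
    \<open>?P j k\<close>.\<close>
  also have "\<dots> = (\<Sum>\<sigma>\<in>perms n. \<Sum>j=0..n. \<Sum>k=0..(n - j) div 2. if \<sigma> \<in> ?P j k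
      then y ^ j * (p ^ nest n \<sigma> * q ^ cros n \<sigma> * (t * w) ^ k * ?c ^ (n - j - 2 * k)) else 0)"
  proof (intro sum.cong refl)
    fix \<sigma> assume \<sigma>: "\<sigma> \<in> perms n"
    let ?s = "\<lambda>j k. y ^ j * (p ^ nest n \<sigma> * q ^ cros n \<sigma> * (t * w) ^ k * ?c ^ (n - j - 2 * k))"
    let ?j = "fixpts n \<sigma>" and ?k = "cvalley n \<sigma>"
    note size = fixpts_cvalley_cda_cdd[OF perm[OF \<sigma>]]
    show "weight p q 0 ?c (t * w) y n (graph n \<sigma>)
        = (\<Sum>j=0..n. \<Sum>k=0..(n - j) div 2. if \<sigma> \<in> ?P j k then ?s j k else 0)"
    proof (cases "cda n \<sigma> = 0")
      case False
      then show ?thesis by (simp add: weight_graph[OF perm[OF \<sigma>]] zero_power)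
    next
      case True
      \<comment> \<open>Once \<open>cda\<close> vanishes, the size identity bounds both indices and
        determines the exponent of \<open>?c\<close>.\<close>
      then have "?j \<le> n" "2 * ?k \<le> n - ?j" and cdd: "cdd n \<sigma> = n - ?j - 2 * ?k"
        using size by linarith+
      then have "?j \<in> {0..n}" "?k \<in> {0..(n - ?j) div 2}"
        by simp_all
      have mem: "\<sigma> \<in> ?P j k \<longleftrightarrow> j = ?j \<and> k = ?k" for j k
        using \<sigma> True by auto
      have "(\<Sum>j=0..n. \<Sum>k=0..(n - j) div 2. if \<sigma> \<in> ?P j k then ?s j k else 0)
          = (\<Sum>j=0..n. if j = ?j then \<Sum>k=0..(n - j) div 2. if k = ?k then ?s j k else 0 else 0)"
        unfolding mem by (intro sum.cong refl) simp
      also have "\<dots> = ?s ?j ?k"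
        using \<open>?j \<in> {0..n}\<close> \<open>?k \<in> {0..(n - ?j) div 2}\<close>
        by (simp only: sum.delta finite_atLeastAtMost if_True)
      also have "\<dots> = weight p q 0 ?c (t * w) y n (graph n \<sigma>)"
        unfolding weight_graph[OF perm[OF \<sigma>]] cdd True by (simp add: ac_simps)
      finally show ?thesis by (rule sym)
    qed
  qed
  also have "\<dots> = (\<Sum>j=0..n. \<Sum>k=0..(n - j) div 2. \<Sum>\<sigma>\<in>perms n. if \<sigma> \<in> ?P j k
      then y ^ j * (p ^ nest n \<sigma> * q ^ cros n \<sigma> * (t * w) ^ k * ?c ^ (n - j - 2 * k)) else 0)"
    by (subst sum.swap, intro sum.cong refl, rule sum.swap)
  also have "\<dots> = (\<Sum>j=0..n. y ^ j * (\<Sum>k=0..(n - j) div 2.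
       b n k j p q * (t * w) ^ k * ?c ^ (n - j - 2 * k)))"
  proof -
    have "(\<Sum>\<sigma>\<in>perms n. if \<sigma> \<in> ?P j k
        then y ^ j * (p ^ nest n \<sigma> * q ^ cros n \<sigma> * (t * w) ^ k * ?c ^ (n - j - 2 * k)) else 0)
      = y ^ j * (b n k j p q * (t * w) ^ k * ?c ^ (n - j - 2 * k))" for j k
    proof -
      have "(\<Sum>\<sigma>\<in>perms n. if \<sigma> \<in> ?P j k
          then y ^ j * (p ^ nest n \<sigma> * q ^ cros n \<sigma> * (t * w) ^ k * ?c ^ (n - j - 2 * k)) else 0)
        = (\<Sum>\<sigma>\<in>perms n. if cvalley n \<sigma> = k \<and> fixpts n \<sigma> = j \<and> cda n \<sigma> = 0
          then y ^ j * (p ^ nest n \<sigma> * q ^ cros n \<sigma> * (t * w) ^ k * ?c ^ (n - j - 2 * k)) else 0)"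
        by (intro sum.cong refl) simp
      also have "\<dots> = (\<Sum>\<sigma>\<in>?P j k.
          y ^ j * (p ^ nest n \<sigma> * q ^ cros n \<sigma> * (t * w) ^ k * ?c ^ (n - j - 2 * k)))"
        by (rule sum.inter_filter[OF finite_perms, symmetric])
      also have "\<dots> = y ^ j * (b n k j p q * (t * w) ^ k * ?c ^ (n - j - 2 * k))"
        by (simp only: b_eq_sum sum_distrib_left sum_distrib_right)
      finally show ?thesis .
    qed
    then show ?thesis by (simp only: sum_distrib_left)
  qed
  finally show ?thesis .
qed

end
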